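(* The outage probability of the integrated link, $P_{\rm out}^{\rm IL}$, is given by $$P_{\rm out}^{\rm IL}=P_{\rm out}^{\rm IoT}+P_{\rm out}^{\rm BHL}-P_{\rm out}^{\rm IoT}\,P_{\rm out}^{\rm BHL},$$ where $P_{\rm out}^{\rm IoT}$ is the outage probability of the IoT network and $P_{\rm out}^{\rm BHL}$ is the outage probability of the backhaul link (BHL).
   Context: System model: an IoT network of $N$ devices sends its data, through one selected device (the aggregate node), to an unmanned aerial vehicle (UAV). The UAV applies the decode-and-forward protocol and forwards the data to the core network over a wireless backhaul link that uses millimeter-wave (mW), free space optical (FSO) and terahertz (THz) technologies simultaneously. Signal-to-noise ratios (SNRs): - IoT network: $\gamma^{\rm IoT}=\max\{\gamma_1,\ldots,\gamma_N\}$ is the SNR of the aggregate node at the UAV. Here $\gamma_i$ is the SNR of the $i$-th device at the UAV under Rayleigh fading, with density $\frac{1}{\bar\gamma^{\rm IoT}}\exp(-\gamma/\bar\gamma^{\rm IoT})$ and average SNR $\bar\gamma^{\rm IoT}$. - Backhaul: let $\gamma^{\rm mW}$, $\gamma^{\rm FSO}$ and $\gamma^{\rm THz}$ be the SNRs of the three backhaul links, each equal to its average SNR times the squared magnitude of its channel coefficient. The mW channel has fluctuating two-ray (FTR) fading. The FSO channel has $\mathcal F$-turbulence with zero-boresight pointing error. The THz channel coefficient is the product of a fading coefficient with a Gaussian mixture density and a pointing error coefficient with density $-\rho^2\ln(y)\,y^{\rho-1}$ on $0<y<1$, where $\rho$ is the pointing error parameter. The SNR $\gamma^{\rm BHL}$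 of the backhaul link is $\gamma^{\rm mW}+\gamma^{\rm FSO}+\gamma^{\rm THz}$ under maximal ratio combining, or $\max\{\gamma^{\rm mW},\gamma^{\rm FSO},\gamma^{\rm THz}\}$ under opportunistic selection combining. - Integrated link: $\gamma^{\rm IL}=\min\{\gamma^{\rm IoT},\gamma^{\rm BHL}\}$. Outage probability: for a threshold $\gamma_{\rm th}$, the outage probability of a link is the probability that its SNR falls below $\gamma_{\rm th}$. Thus $P_{\rm out}^{\rm IL}=P(\gamma^{\rm IL}<\gamma_{\rm th})$, $P_{\rm out}^{\rm IoT}=P(\gamma^{\rm IoT}<\gamma_{\rm th})$ and $P_{\rm out}^{\rm BHL}=P(\gamma^{\rm BHL}<\gamma_{\rm th})$.
   Formalization: The formal theorem adds the assumption, not stated but needed for the product formula, that the vector of device SNRs is independent of the vector of the mW, FSO and THz backhaul channel coefficients. *)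

theory Defs
  imports "HOL-Probability.Probability"
begin

definition outage_probability :: "'a measure \<Rightarrow> ('a \<Rightarrow> real) \<Rightarrow> real \<Rightarrow> real" where
  "outage_probability M snr \<gamma>th = measure M {\<omega> \<in> space M. snr \<omega> < \<gamma>th}"

definition iot_snr :: "nat \<Rightarrow> (nat \<Rightarrow> 'a \<Rightarrow> real) \<Rightarrow> 'a \<Rightarrow> real" where
  "iot_snr N \<gamma> \<omega> = Max ((\<lambda>i. \<gamma> i \<omega>) ` {1..N})"

datatype combining = Maximal_Ratio | Opportunistic_Selection

fun backhaul_snr ::
  "combining \<Rightarrow> ('a \<Rightarrow> real) \<Rightarrow> ('a \<Rightarrow> real) \<Rightarrow> ('a \<Rightarrow> real) \<Rightarrow> 'a \<Rightarrow> real" where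
  "backhaul_snr Maximal_Ratio \<gamma>mW \<gamma>FSO \<gamma>THz \<omega> = \<gamma>mW \<omega> + \<gamma>FSO \<omega> + \<gamma>THz \<omega>"
| "backhaul_snr Opportunistic_Selection \<gamma>mW \<gamma>FSO \<gamma>THz \<omega> = Max {\<gamma>mW \<omega>, \<gamma>FSO \<omega>, \<gamma>THz \<omega>}"

definition integrated_snr :: "('a \<Rightarrow> real) \<Rightarrow> ('a \<Rightarrow> real) \<Rightarrow> 'a \<Rightarrow> real" where
  "integrated_snr \<gamma>IoT \<gamma>BHL \<omega> = min (\<gamma>IoT \<omega>) (\<gamma>BHL \<omega>)"

definition channel_snr :: "real \<Rightarrow> ('a \<Rightarrow> 'b::real_normed_vector) \<Rightarrow> 'a \<Rightarrow> real" where
  "channel_snr avg h \<omega> = avg * (norm (h \<omega>))\<^sup>2"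

(* Rayleigh fading makes the SNR (not the amplitude) exponentially distributed. *)
definition rayleigh_snr :: "'a measure \<Rightarrow> real \<Rightarrow> ('a \<Rightarrow> real) \<Rightarrow> bool" where
  "rayleigh_snr M avg \<gamma> \<longleftrightarrow> distributed M lborel \<gamma> (exponential_density (1 / avg))"

(* Unit-mean Gamma density of shape m; erlang_density only covers integer shapes. *)
definition unit_gamma_density :: "real \<Rightarrow> real \<Rightarrow> real" where
  "unit_gamma_density m x =
     (if 0 < x then m powr m * x powr (m - 1) * exp (- m * x) / Gamma m else 0)"

(* Fluctuating two-ray fading: the law of
     sqrt \<zeta> * (V1 * exp (i * \<phi>1) + V2 * exp (i * \<phi>2)) + X + i * Y
   with independent \<zeta> (unit-mean Gamma), \<phi>1 and \<phi>2 (uniform phases of the two specular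
   waves), X and Y (diffuse part, normal with mean 0 and standard deviation \<sigma>).
   The usual parameters are K = (V1^2 + V2^2) / (2 * \<sigma>^2) and
   \<Delta> = 2 * V1 * V2 / (V1^2 + V2^2). *)
definition ftr_law :: "real \<Rightarrow> real \<Rightarrow> real \<Rightarrow> real \<Rightarrow> complex measure" where
  "ftr_law m V1 V2 \<sigma> =
     distr
       (density lborel (unit_gamma_density m)
         \<Otimes>\<^sub>M uniform_measure lborel {0..2 * pi} \<Otimes>\<^sub>M uniform_measure lborel {0..2 * pi}
         \<Otimes>\<^sub>M density lborel (normal_density 0 \<sigma>) \<Otimes>\<^sub>M density lborel (normal_density 0 \<sigma>))
       borel
       (\<lambda>(\<zeta>, \<phi>1, \<phi>2, x, y).
          of_real (sqrt \<zeta>) * (of_real V1 * cis \<phi>1 + of_real V2 * cis \<phi>2)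
            + (of_real x + \<i> * of_real y))"

definition ftr_fading ::
  "'a measure \<Rightarrow> real \<Rightarrow> real \<Rightarrow> real \<Rightarrow> real \<Rightarrow> ('a \<Rightarrow> complex) \<Rightarrow> bool" where
  "ftr_fading M m V1 V2 \<sigma> h \<longleftrightarrow>
     0 < m \<and> 0 \<le> V1 \<and> 0 \<le> V2 \<and> 0 < \<sigma> \<and>
     h \<in> borel_measurable M \<and> distr M borel h = ftr_law m V1 V2 \<sigma>"

(* Density of the Fisher-Snedecor F distribution of the unit-mean irradiance; it is a
   probability density with mean 1 for \<alpha> > 0 and \<beta> > 1. *)
definition F_turbulence_density :: "real \<Rightarrow> real \<Rightarrow> real \<Rightarrow> real" where
  "F_turbulence_density \<alpha> \<beta> x =
     (if 0 < x
      then \<alpha> powr \<alpha> * (\<beta> - 1) powr \<beta> * x powr (\<alpha> - 1) /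
             (Beta \<alpha> \<beta> * (\<alpha> * x + \<beta> - 1) powr (\<alpha> + \<beta>))
      else 0)"

(* Zero-boresight pointing error: A0 is the fraction of power collected at zero displacement
   and \<xi> the ratio of the equivalent beam radius to twice the jitter standard deviation. *)
definition zero_boresight_density :: "real \<Rightarrow> real \<Rightarrow> real \<Rightarrow> real" where
  "zero_boresight_density \<xi> A0 x =
     (if 0 < x \<and> x < A0 then \<xi>\<^sup>2 / A0 powr (\<xi>\<^sup>2) * x powr (\<xi>\<^sup>2 - 1) else 0)"

definition fso_fading ::
  "'a measure \<Rightarrow> real \<Rightarrow> real \<Rightarrow> real \<Rightarrow> real \<Rightarrow> ('a \<Rightarrow> real) \<Rightarrow> bool" where
  "fso_fading M \<alpha> \<beta> \<xi> A0 h \<longleftrightarrow>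
     0 < \<alpha> \<and> 1 < \<beta> \<and> 0 < \<xi> \<and> 0 < A0 \<and>
     (\<exists>ht hp. distributed M lborel ht (F_turbulence_density \<alpha> \<beta>) \<and>
              distributed M lborel hp (zero_boresight_density \<xi> A0) \<and>
              h = (\<lambda>\<omega>. ht \<omega> * hp \<omega>))"

definition gaussian_mixture_density ::
  "nat \<Rightarrow> (nat \<Rightarrow> real) \<Rightarrow> (nat \<Rightarrow> real) \<Rightarrow> (nat \<Rightarrow> real) \<Rightarrow> real \<Rightarrow> real" where
  "gaussian_mixture_density K w \<mu> \<sigma> x = (\<Sum>k=1..K. w k * normal_density (\<mu> k) (\<sigma> k) x)"

definition thz_pointing_density :: "real \<Rightarrow> real \<Rightarrow> real" where
  "thz_pointing_density \<rho> y =
     (if 0 < y \<and> y < 1 then - (\<rho>\<^sup>2) * ln y * y powr (\<rho> - 1) else 0)"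

definition thz_fading ::
  "'a measure \<Rightarrow> nat \<Rightarrow> (nat \<Rightarrow> real) \<Rightarrow> (nat \<Rightarrow> real) \<Rightarrow> (nat \<Rightarrow> real) \<Rightarrow> real
     \<Rightarrow> ('a \<Rightarrow> real) \<Rightarrow> bool" where
  "thz_fading M K w \<mu> \<sigma> \<rho> h \<longleftrightarrow>
     (\<forall>k\<in>{1..K}. 0 \<le> w k \<and> 0 < \<sigma> k) \<and> (\<Sum>k=1..K. w k) = 1 \<and> 0 < \<rho> \<and>
     (\<exists>hf hp. distributed M lborel hf (gaussian_mixture_density K w \<mu> \<sigma>) \<and>
              distributed M lborel hp (thz_pointing_density \<rho>) \<and>
              h = (\<lambda>\<omega>. hf \<omega> * hp \<omega>))"

(* prob_space.indep_var requires both random variables to have the same value type, so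
   independence of X and Y is stated for the sigma-algebras they generate. *)
definition indep_rv ::
  "'a measure \<Rightarrow> 'b measure \<Rightarrow> ('a \<Rightarrow> 'b) \<Rightarrow> 'c measure \<Rightarrow> ('a \<Rightarrow> 'c) \<Rightarrow> bool" where
  "indep_rv M A X B Y \<longleftrightarrow>
     X \<in> measurable M A \<and> Y \<in> measurable M B \<and>
     prob_space.indep_set M (sets (vimage_algebra (space M) X A))
                            (sets (vimage_algebra (space M) Y B))"

end

theory Submission
  imports Defs
begin

text \<open>The minimum of two SNRs lies below the threshold exactly when at least one of them does,
  so the outage event of the integrated link is the union of the outage events of its two hops.
  Inclusion-exclusion gives the sum minus the probability of the intersection, and independence
  turns that probability into a product. \<open>outage_probability_integrated_snr\<close> carries
  this argument for arbitrary measurable functions \<open>f\<close> and \<open>g\<close> of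
  independent random variables \<open>X\<close> and \<open>Y\<close>. In the theorem
  \<open>X\<close> is the tuple of device SNRs and \<open>Y\<close> the triple of backhaul
  coefficients; the other two lemmas supply the measurability of the hop SNRs as functions of
  these.\<close>

lemma (in prob_space) outage_probability_integrated_snr:
  assumes indep: "indep_rv M A X B Y"
    and f: "f \<in> borel_measurable A" and g: "g \<in> borel_measurable B"
  shows "outage_probability M (integrated_snr (\<lambda>\<omega>. f (X \<omega>)) (\<lambda>\<omega>. g (Y \<omega>))) t =
           outage_probability M (\<lambda>\<omega>. f (X \<omega>)) t + outage_probability M (\<lambda>\<omega>. g (Y \<omega>)) t
           - outage_probability M (\<lambda>\<omega>. f (X \<omega>)) t * outage_probability M (\<lambda>\<omega>. g (Y \<omega>)) t"
proof -
  from indep have X[measurable]: "X \<in> measurable M A" and Y[measurable]: "Y \<in> measurable M B"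
    and ind: "indep_set (sets (vimage_algebra (space M) X A)) (sets (vimage_algebra (space M) Y B))"
    by (auto simp: indep_rv_def)
  note [measurable] = f g
  define E where "E = {\<omega> \<in> space M. f (X \<omega>) < t}"
  define F where "F = {\<omega> \<in> space M. g (Y \<omega>) < t}"
  have ev: "E \<in> events" "F \<in> events"
    unfolding E_def F_def by measurable
  \<comment> \<open>Independence is a statement about the sigma-algebras generated by
    \<open>X\<close> and \<open>Y\<close>, so being an event of \<open>M\<close> is not enough:
    \<open>E\<close> and \<open>F\<close> must be exhibited as preimages of measurable sets under
    \<open>X\<close> and \<open>Y\<close>.\<close>
  have "{x \<in> space A. f x < t} \<in> sets A"
    by measurable
  moreover have "E = X -` {x \<in> space A. f x < t} \<inter> space M"
    using measurable_space[OF X] by (auto simp: E_def)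
  ultimately have E: "E \<in> sets (vimage_algebra (space M) X A)"
    by (simp only: in_vimage_algebra)
  have "{y \<in> space B. g y < t} \<in> sets B"
    by measurable
  moreover have "F = Y -` {y \<in> space B. g y < t} \<inter> space M"
    using measurable_space[OF Y] by (auto simp: F_def)
  ultimately have F: "F \<in> sets (vimage_algebra (space M) Y B)"
    by (simp only: in_vimage_algebra)
  have "{\<omega> \<in> space M. min (f (X \<omega>)) (g (Y \<omega>)) < t} = E \<union> F"
    by (auto simp: E_def F_def min_less_iff_disj)
  moreover have "prob (E \<union> F) = prob E + prob F - prob (E \<inter> F)"
    using ev by (intro measure_Un3) (auto simp: fmeasurable_eq_sets)
  moreover have "prob (E \<inter> F) = prob E * prob F"
    using ind E F by (rule indep_setD)
  ultimately show ?thesis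
    by (simp add: outage_probability_def integrated_snr_def E_def F_def)
qed

text \<open>A finite nonempty maximum is below \<open>t\<close> iff every coordinate is, so each
  strict sublevel set is a finite intersection of measurable coordinate conditions.\<close>

lemma borel_measurable_Max_PiM:
  assumes "finite I" "I \<noteq> {}"
  shows "(\<lambda>x. Max (x ` I) :: real) \<in> borel_measurable (Pi\<^sub>M I (\<lambda>_. borel))"
proof (rule borel_measurableI_less)
  fix t :: real
  have "{x \<in> space (Pi\<^sub>M I (\<lambda>_. borel)). Max (x ` I) < t} =
          {x \<in> space (Pi\<^sub>M I (\<lambda>_. borel)). \<forall>i\<in>I. x i < t}"
    using assms by simp
  also have "\<dots> \<in> sets (Pi\<^sub>M I (\<lambda>_. borel))"
    using assms(1) by measurable
  finally show "{x \<in> space (Pi\<^sub>M I (\<lambda>_. borel)). Max (x ` I) < t} \<in> sets (Pi\<^sub>M I (\<lambda>_. borel))" .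
qed

text \<open>Squared norms, sums and maxima are continuous, so under either combining rule the SNR is
  a continuous function of the coefficient triple, hence Borel on the product space.\<close>

lemma borel_measurable_backhaul_snr:
  "(\<lambda>h. backhaul_snr comb (channel_snr a fst) (channel_snr b (\<lambda>h. fst (snd h)))
           (channel_snr c (\<lambda>h. snd (snd h))) h)
     \<in> borel_measurable
          (borel :: ('b::real_normed_vector \<times> 'c::real_normed_vector \<times> 'd::real_normed_vector) measure)"
  by (rule borel_measurable_continuous_onI, cases comb)
     (auto simp: channel_snr_def intro!: continuous_intros)

theorem lemma2:
  fixes M :: "'a measure"
    and N :: nat
    and \<gamma> :: "nat \<Rightarrow> 'a \<Rightarrow> real"
    and h_mW :: "'a \<Rightarrow> complex"
    and h_FSO h_THz :: "'a \<Rightarrow> real"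
    and \<gamma>_IoT \<gamma>_mW \<gamma>_FSO \<gamma>_THz \<gamma>_BHL \<gamma>_IL :: "'a \<Rightarrow> real"
    and avg_IoT avg_mW avg_FSO avg_THz :: real
    and m V1 V2 \<sigma> :: real
    and \<alpha> \<beta> \<xi> A0 :: real
    and K :: nat and w \<mu> s :: "nat \<Rightarrow> real" and \<rho> :: real
    and comb :: combining
    and \<gamma>_th :: real
  assumes "prob_space M"
    and "1 \<le> N"
    and "0 < avg_IoT" "0 < avg_mW" "0 < avg_FSO" "0 < avg_THz"
    and "\<And>i. i \<in> {1..N} \<Longrightarrow> rayleigh_snr M avg_IoT (\<gamma> i)"
    and "ftr_fading M m V1 V2 \<sigma> h_mW"
    and "fso_fading M \<alpha> \<beta> \<xi> A0 h_FSO"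
    and "thz_fading M K w \<mu> s \<rho> h_THz"
    and "\<gamma>_IoT = iot_snr N \<gamma>"
    and "\<gamma>_mW = channel_snr avg_mW h_mW"
    and "\<gamma>_FSO = channel_snr avg_FSO h_FSO"
    and "\<gamma>_THz = channel_snr avg_THz h_THz"
    and "\<gamma>_BHL = backhaul_snr comb \<gamma>_mW \<gamma>_FSO \<gamma>_THz"
    and "\<gamma>_IL = integrated_snr \<gamma>_IoT \<gamma>_BHL"
    and "indep_rv M
           (Pi\<^sub>M {1..N} (\<lambda>_. borel)) (\<lambda>\<omega>. \<lambda>i\<in>{1..N}. \<gamma> i \<omega>)
           (borel :: (complex \<times> real \<times> real) measure) (\<lambda>\<omega>. (h_mW \<omega>, h_FSO \<omega>, h_THz \<omega>))"
  shows "outage_probability M \<gamma>_IL \<gamma>_th =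
           outage_probability M \<gamma>_IoT \<gamma>_th + outage_probability M \<gamma>_BHL \<gamma>_th
           - outage_probability M \<gamma>_IoT \<gamma>_th * outage_probability M \<gamma>_BHL \<gamma>_th"
proof -
  interpret prob_space M by fact
  let ?f = "\<lambda>x. Max (x ` {1..N}) :: real"
  let ?g = "\<lambda>h :: complex \<times> real \<times> real. backhaul_snr comb (channel_snr avg_mW fst)
    (channel_snr avg_FSO (\<lambda>h. fst (snd h))) (channel_snr avg_THz (\<lambda>h. snd (snd h))) h"
  \<comment> \<open>Restricting the tuple to \<open>{1..N}\<close>, as the product space demands,
    does not change the maximum, which is taken over these indices only.\<close>
  have IoT: "\<gamma>_IoT = (\<lambda>\<omega>. ?f (\<lambda>i\<in>{1..N}. \<gamma> i \<omega>))"
    unfolding \<open>\<gamma>_IoT = _\<close> by (simp add: iot_snr_def fun_eq_iff cong: image_cong_simp)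
  have BHL: "\<gamma>_BHL = (\<lambda>\<omega>. ?g (h_mW \<omega>, h_FSO \<omega>, h_THz \<omega>))"
    unfolding \<open>\<gamma>_BHL = _\<close> \<open>\<gamma>_mW = _\<close> \<open>\<gamma>_FSO = _\<close> \<open>\<gamma>_THz = _\<close>
    by (cases comb) (simp_all add: channel_snr_def fun_eq_iff)
  have "?f \<in> borel_measurable (Pi\<^sub>M {1..N} (\<lambda>_. borel))"
    \<comment> \<open>At least one device makes the index set nonempty, so that \<open>Max\<close>
      is meaningful.\<close>
    using \<open>1 \<le> N\<close> by (intro borel_measurable_Max_PiM) auto
  from outage_probability_integrated_snr[OF assms(17) this borel_measurable_backhaul_snr]
  show ?thesis
    unfolding \<open>\<gamma>_IL = _\<close> IoT BHL .
qed

end
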